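(* Let $(h,\mathbf v)$ be a solution of $$(1-c_s^2)v^\kappa\partial_\kappa h+c_s^2\partial_\kappa v^\kappa=0,\qquad v^\kappa\partial_\kappa v^\alpha+\mathrm{e}^{2h}\partial^\alpha h=0\quad(\alpha=0,1,2).$$ Let $g^{\alpha\beta}=\Theta\{c_s^2m^{\alpha\beta}+\mathrm{e}^{-2h}(c_s^2-1)v^\alpha v^\beta\}$ with $\Theta=\{c_s^2-\mathrm{e}^{-2h}(c_s^2-1)(v^0)^2\}^{-1}$, and let $w^\alpha=\epsilon^{\alpha\beta\gamma}\partial_\beta v_\gamma$. Then the system can be written as $$\square_gh=\mathcal D,\qquad \square_gv^\alpha=-c_s^2\Theta\,\epsilon^{\alpha\beta\gamma}\partial_\beta w_\gamma+Q^\alpha,\qquad v^\kappa\partial_\kappa w^\alpha=w^\kappa\partial^\alpha v_\kappa-w^\alpha\partial_\kappa v^\kappa,$$ where $\square_g=g^{\alpha\beta}\partial^2_{\alpha\beta}$ and $\mathcal D$ and $(Q^0,Q^1,Q^2)$ are the quadratic terms $$\mathcal D=-2\mathrm{e}^{-2h}\Theta c_s^{-1}c_s'v^\beta v^\kappa\partial_\beta h\,\partial_\kappa h-\mathrm{e}^{-2h}\Theta c_s^2\partial_\kappa v^\beta\partial_\beta v^\kappa-\Theta(1+c_s^2)\partial_\kappa h\,\partial^\kappa h,$$ $$\begin{aligned}Q^\alpha=&-\mathrm{e}^{-2h}(c_s^2-1)\Theta v^\beta\partial_\beta v^\kappa\partial_\kappa v^\alpha-2(c_s^2-1)\Theta v^\beta\partial_\beta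 h\,\partial^\alpha h-2\Theta c_sc_s'\,\partial^\alpha h\,\partial_\kappa v^\kappa\\&+(c_s^2-1)\Theta\,\partial^\alpha v^\beta\partial_\beta h+2\Theta c_sc_s'\,v^\beta\partial^\alpha h\,\partial_\beta h.\end{aligned}$$
   Context: Space-time is $\mathbb R^{1+2}$ with coordinates $(t,x)$, $\partial_0=\partial_t$. Greek indices run over $0,1,2$; repeated indices are summed; indices are raised and lowered with $m=\mathrm{diag}(-1,1,1)$; $\epsilon^{\alpha\beta\gamma}$ is the totally antisymmetric symbol. $h$ is the logarithmic enthalpy and $\mathbf v=(v^0,v^1,v^2)$ the rescaled velocity of a relativistic fluid, normalized by $v^\alpha v_\alpha=-\mathrm{e}^{2h}$, $v^0>0$; $c_s=c_s(h)$ is the sound speed, a smooth function of $h$ with $0<c_s\le1$, and $c_s'=dc_s/dh$. Solutions are taken sufficiently smooth.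
   Formalization: The vorticity term in the equation for v^α is taken as +c_s²Θ ε^{αβγ}∂_β w_γ instead of the printed −c_s²Θ ε^{αβγ}∂_β w_γ, since the minus sign is false when indices are lowered with m = diag(-1,1,1). *)

theory Defs
  imports "HOL-Analysis.Analysis"
begin

text \<open>
  Points of space-time are vectors of type \<open>real ^ 3\<close>.  The index type \<open>3\<close> is the
  type of integers modulo three, so its elements are exactly \<open>0\<close>, \<open>1\<close>, \<open>2\<close>, and
  \<open>x $ 0\<close> is the time coordinate.  A vector field \<open>V :: real ^ 3 \<Rightarrow> real ^ 3\<close> is always
  given by its contravariant components \<open>V x $ \<alpha>\<close>.
\<close>

definition mink :: "3 \<Rightarrow> 3 \<Rightarrow> real" where
  "mink \<alpha> \<beta> = (if \<alpha> = \<beta> then (if \<alpha> = 0 then -1 else 1) else 0)"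

definition eps :: "3 \<Rightarrow> 3 \<Rightarrow> 3 \<Rightarrow> real" where
  "eps \<alpha> \<beta> \<gamma> =
     (if (\<alpha>, \<beta>, \<gamma>) \<in> {(0, 1, 2), (1, 2, 0), (2, 0, 1)} then 1
      else if (\<alpha>, \<beta>, \<gamma>) \<in> {(0, 2, 1), (2, 1, 0), (1, 0, 2)} then -1
      else 0)"

definition pd :: "3 \<Rightarrow> (real ^ 3 \<Rightarrow> real) \<Rightarrow> real ^ 3 \<Rightarrow> real" where
  "pd \<alpha> f x = frechet_derivative f (at x) (axis \<alpha> 1)"

definition pd_up :: "3 \<Rightarrow> (real ^ 3 \<Rightarrow> real) \<Rightarrow> real ^ 3 \<Rightarrow> real" where
  "pd_up \<alpha> f x = (\<Sum>\<beta>\<in>UNIV. mink \<alpha> \<beta> * pd \<beta> f x)"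

definition up :: "(real ^ 3 \<Rightarrow> real ^ 3) \<Rightarrow> 3 \<Rightarrow> real ^ 3 \<Rightarrow> real" where
  "up V \<alpha> x = V x $ \<alpha>"

definition low :: "(real ^ 3 \<Rightarrow> real ^ 3) \<Rightarrow> 3 \<Rightarrow> real ^ 3 \<Rightarrow> real" where
  "low V \<alpha> x = (\<Sum>\<beta>\<in>UNIV. mink \<alpha> \<beta> * V x $ \<beta>)"

text \<open>For open \<open>U\<close> this is the class of twice continuously differentiable functions on \<open>U\<close>.\<close>

definition C2_on :: "(real ^ 3) set \<Rightarrow> (real ^ 3 \<Rightarrow> real) \<Rightarrow> bool" where
  "C2_on U f \<longleftrightarrow>
     f differentiable_on U \<and>
     (\<forall>\<alpha>. pd \<alpha> f differentiable_on U) \<and>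
     (\<forall>\<alpha> \<beta>. continuous_on U (pd \<beta> (pd \<alpha> f)))"

definition smooth_real_on :: "real set \<Rightarrow> (real \<Rightarrow> real) \<Rightarrow> bool" where
  "smooth_real_on I f \<longleftrightarrow> (\<forall>k. (deriv ^^ k) f differentiable_on I)"

definition div_field :: "(real ^ 3 \<Rightarrow> real ^ 3) \<Rightarrow> real ^ 3 \<Rightarrow> real" where
  "div_field V x = (\<Sum>\<kappa>\<in>UNIV. pd \<kappa> (up V \<kappa>) x)"

text \<open>
  The field \<open>curl V\<close> has the components
  \<open>\<epsilon>\<^sup>\<alpha>\<^sup>\<beta>\<^sup>\<gamma> \<partial>\<^sub>\<beta> V\<^sub>\<gamma>\<close>, with the index of \<open>V\<close> lowered by \<open>mink\<close>.
  The vorticity of \<open>v\<close> is \<open>curl v\<close>.  Since \<open>mink\<close> has determinant \<open>-1\<close>, iterating gives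
  \<open>curl (curl V)\<^sup>\<alpha> = m\<^sup>\<beta>\<^sup>\<gamma> \<partial>\<^sub>\<beta> \<partial>\<^sub>\<gamma> V\<^sup>\<alpha> - \<partial>\<^sup>\<alpha> (div V)\<close>, whose sign is
  opposite to that of the Euclidean identity.  For this reason the term
  \<open>c\<^sub>s\<^sup>2 \<Theta> \<epsilon>\<^sup>\<alpha>\<^sup>\<beta>\<^sup>\<gamma> \<partial>\<^sub>\<beta> w\<^sub>\<gamma>\<close> enters the wave equation for the velocity with a
  plus sign; the minus sign found in the source results from the Euclidean identity
  and contradicts the lowering of indices with \<open>mink\<close>.
\<close>

definition curl :: "(real ^ 3 \<Rightarrow> real ^ 3) \<Rightarrow> real ^ 3 \<Rightarrow> real ^ 3" where
  "curl V x = (\<chi> \<alpha>. \<Sum>\<beta>\<in>UNIV. \<Sum>\<gamma>\<in>UNIV. eps \<alpha> \<beta> \<gamma> * pd \<beta> (low V \<gamma>) x)"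

definition Theta :: "(real \<Rightarrow> real) \<Rightarrow> (real ^ 3 \<Rightarrow> real) \<Rightarrow> (real ^ 3 \<Rightarrow> real ^ 3) \<Rightarrow> real ^ 3 \<Rightarrow> real" where
  "Theta cs h v x =
     inverse ((cs (h x))\<^sup>2 - exp (- 2 * h x) * ((cs (h x))\<^sup>2 - 1) * (up v 0 x)\<^sup>2)"

text \<open>The components \<open>g\<^sup>\<alpha>\<^sup>\<beta>\<close> of the (inverse) acoustical metric, and its wave operator.\<close>

definition acoustic ::
  "(real \<Rightarrow> real) \<Rightarrow> (real ^ 3 \<Rightarrow> real) \<Rightarrow> (real ^ 3 \<Rightarrow> real ^ 3) \<Rightarrow> 3 \<Rightarrow> 3 \<Rightarrow> real ^ 3 \<Rightarrow> real" where
  "acoustic cs h v \<alpha> \<beta> x =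
     Theta cs h v x *
       ((cs (h x))\<^sup>2 * mink \<alpha> \<beta>
        + exp (- 2 * h x) * ((cs (h x))\<^sup>2 - 1) * up v \<alpha> x * up v \<beta> x)"

definition wave_op ::
  "(real \<Rightarrow> real) \<Rightarrow> (real ^ 3 \<Rightarrow> real) \<Rightarrow> (real ^ 3 \<Rightarrow> real ^ 3) \<Rightarrow>
   (real ^ 3 \<Rightarrow> real) \<Rightarrow> real ^ 3 \<Rightarrow> real" where
  "wave_op cs h v f x =
     (\<Sum>\<alpha>\<in>UNIV. \<Sum>\<beta>\<in>UNIV. acoustic cs h v \<alpha> \<beta> x * pd \<alpha> (pd \<beta> f) x)"

definition D_term ::
  "(real \<Rightarrow> real) \<Rightarrow> (real ^ 3 \<Rightarrow> real) \<Rightarrow> (real ^ 3 \<Rightarrow> real ^ 3) \<Rightarrow> real ^ 3 \<Rightarrow> real" where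
  "D_term cs h v x =
     (let c = cs (h x); c' = deriv cs (h x); \<Theta> = Theta cs h v x; e = exp (- 2 * h x) in
      - 2 * e * \<Theta> * inverse c * c'
          * (\<Sum>\<beta>\<in>UNIV. \<Sum>\<kappa>\<in>UNIV. up v \<beta> x * up v \<kappa> x * pd \<beta> h x * pd \<kappa> h x)
      - e * \<Theta> * c\<^sup>2 * (\<Sum>\<kappa>\<in>UNIV. \<Sum>\<beta>\<in>UNIV. pd \<kappa> (up v \<beta>) x * pd \<beta> (up v \<kappa>) x)
      - \<Theta> * (1 + c\<^sup>2) * (\<Sum>\<kappa>\<in>UNIV. pd \<kappa> h x * pd_up \<kappa> h x))"

definition Q_term ::
  "(real \<Rightarrow> real) \<Rightarrow> (real ^ 3 \<Rightarrow> real) \<Rightarrow> (real ^ 3 \<Rightarrow> real ^ 3) \<Rightarrow> 3 \<Rightarrow> real ^ 3 \<Rightarrow> real" where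
  "Q_term cs h v \<alpha> x =
     (let c = cs (h x); c' = deriv cs (h x); \<Theta> = Theta cs h v x; e = exp (- 2 * h x) in
      - e * (c\<^sup>2 - 1) * \<Theta>
          * (\<Sum>\<beta>\<in>UNIV. \<Sum>\<kappa>\<in>UNIV. up v \<beta> x * pd \<beta> (up v \<kappa>) x * pd \<kappa> (up v \<alpha>) x)
      - 2 * (c\<^sup>2 - 1) * \<Theta> * (\<Sum>\<beta>\<in>UNIV. up v \<beta> x * pd \<beta> h x * pd_up \<alpha> h x)
      - 2 * \<Theta> * c * c' * pd_up \<alpha> h x * div_field v x
      + (c\<^sup>2 - 1) * \<Theta> * (\<Sum>\<beta>\<in>UNIV. pd_up \<alpha> (up v \<beta>) x * pd \<beta> h x)
      + 2 * \<Theta> * c * c' * (\<Sum>\<beta>\<in>UNIV. up v \<beta> x * pd_up \<alpha> h x * pd \<beta> h x))"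

end

theory Submission
  imports Defs
begin

text \<open>
  Write \<open>B = v\<^sup>\<kappa> \<partial>\<^sub>\<kappa>\<close> for differentiation along the flow. The equations are the continuity equation
  \<open>(1 - c\<^sub>s\<^sup>2) B h + c\<^sub>s\<^sup>2 div v = 0\<close> and the momentum equation \<open>B v\<^sup>\<alpha> = - e\<^sup>2\<^sup>h \<partial>\<^sup>\<alpha> h\<close>.
  Up to the factor \<open>\<Theta>\<close> the acoustical wave operator is a combination of the flat d'Alembertian and of
  \<open>v\<^sup>\<alpha> v\<^sup>\<beta> \<partial>\<^sub>\<alpha> \<partial>\<^sub>\<beta>\<close>, and the latter equals \<open>B B\<close> up to the first order term
  \<open>(B v\<^sup>\<beta>) \<partial>\<^sub>\<beta>\<close> (\<open>wave_op_split\<close>). So only \<open>B B h\<close> and \<open>B B v\<^sup>\<alpha>\<close> have to be found, and the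
  differentiated equations of motion give them in a form that cancels against the flat part.

  Enthalpy: \<open>B\<close> of the continuity equation expresses \<open>B B h\<close> through \<open>B div v\<close>. The divergence of
  the momentum equation turns \<open>B div v\<close> into \<open>- e\<^sup>2\<^sup>h\<close> times the d'Alembertian of \<open>h\<close> up to
  quadratic terms, because \<open>B\<close> and the divergence commute up to the quadratic term \<open>\<partial>\<^sub>\<kappa> v\<^sup>\<beta> \<partial>\<^sub>\<beta> v\<^sup>\<kappa>\<close> (\<open>divergence_transport\<close>).

  Velocity: \<open>B\<close> of the momentum equation expresses \<open>B B v\<^sup>\<alpha>\<close> through \<open>\<partial>\<^sup>\<alpha> B h\<close>. In Minkowski space
  the d'Alembertian of \<open>v\<^sup>\<alpha>\<close> is \<open>(curl (curl v))\<^sup>\<alpha> + \<partial>\<^sup>\<alpha> div v\<close> (\<open>curl_curl\<close>). The gradient of the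
  continuity equation trades \<open>c\<^sub>s\<^sup>2 \<partial>\<^sup>\<alpha> div v\<close> for \<open>(c\<^sub>s\<^sup>2 - 1) \<partial>\<^sup>\<alpha> B h\<close> up to
  quadratic terms, and then all second derivatives cancel except those in the curl of the vorticity.

  Vorticity: the right side of the momentum equation is a gradient, \<open>- \<partial>\<^sub>\<gamma> (e\<^sup>2\<^sup>h) / 2\<close>, so the curl of
  \<open>B v\<close> vanishes. Commuting \<open>B\<close> with the curl leaves an identity between quadratic forms in
  the first derivatives of \<open>v\<close> (\<open>vorticity_transport\<close>).

  All this rests on commuting second partial derivatives, which for \<open>C\<^sup>2\<close> functions is Schwarz's
  theorem (\<open>pd_commute\<close>).
\<close>

section \<open>Sums over space-time indices\<close>

lemma sum_index: "(\<Sum>\<alpha>\<in>UNIV. f \<alpha>) = f 0 + f 1 + f (2::3)"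
proof -
  have "(3::3) = 0" by simp
  from sum_3[of f, unfolded this] show ?thesis by (simp add: ac_simps)
qed

lemma all_index: "(\<forall>\<alpha>::3. P \<alpha>) \<longleftrightarrow> P 0 \<and> P 1 \<and> P 2"
proof -
  have "(3::3) = 0" by simp
  from forall_3[of P, unfolded this] show ?thesis by blast
qed

lemma sum_mink: "(\<Sum>\<beta>\<in>UNIV. mink \<alpha> \<beta> * f \<beta>) = mink \<alpha> \<alpha> * f \<alpha>"
proof -
  have "(\<Sum>\<beta>\<in>UNIV. mink \<alpha> \<beta> * f \<beta>) = (\<Sum>\<beta>\<in>UNIV. if \<beta> = \<alpha> then mink \<alpha> \<alpha> * f \<alpha> else 0)"
    by (intro sum.cong) (auto simp: mink_def)
  then show ?thesis by simp
qed

lemma pd_up_eq: "pd_up \<alpha> f x = mink \<alpha> \<alpha> * pd \<alpha> f x"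
  by (simp add: pd_up_def sum_mink)

lemma low_eq: "low V \<alpha> = (\<lambda>x. mink \<alpha> \<alpha> * up V \<alpha> x)"
  by (simp add: fun_eq_iff low_def sum_mink up_def)

section \<open>Calculus of partial derivatives\<close>

lemma pd_eqI: "(f has_derivative D) (at x) \<Longrightarrow> pd \<alpha> f x = D (axis \<alpha> 1)"
  by (metis frechet_derivative_at pd_def)

lemma pd_cong:
  assumes "open U" "x \<in> U" "\<And>y. y \<in> U \<Longrightarrow> f y = g y" "f differentiable at x"
  shows "pd \<alpha> f x = pd \<alpha> g x"
proof -
  have "frechet_derivative f (at x) = frechet_derivative g (at x)"
    using assms by (metis frechet_derivative_transform_within_open)
  then show ?thesis by (simp add: pd_def)
qed

lemma differentiable_cong_on_open:
  assumes "open U" "x \<in> U" "\<And>y. y \<in> U \<Longrightarrow> f y = g y" "f differentiable at x"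
  shows "g differentiable at x"
  using assms by (metis differentiable_def has_derivative_transform_within_open)

lemma pd_mult:
  assumes "f differentiable at x" "g differentiable at x"
  shows "pd \<alpha> (\<lambda>y. f y * g y) x = pd \<alpha> f x * g x + f x * pd \<alpha> g x"
  using pd_eqI[OF has_derivative_mult[OF assms[unfolded frechet_derivative_works]]]
  by (simp add: pd_def)

lemma pd_const: "pd \<alpha> (\<lambda>y. k) x = 0"
  by (simp add: pd_def)

lemma pd_cmult:
  assumes "f differentiable at x"
  shows "pd \<alpha> (\<lambda>y. k * f y) x = k * pd \<alpha> f x"
  using pd_mult[OF differentiable_const assms, of \<alpha> k] by (simp add: pd_const)

lemma pd_sum:
  assumes "\<And>i. i \<in> S \<Longrightarrow> f i differentiable at x"
  shows "pd \<alpha> (\<lambda>y. \<Sum>i\<in>S. f i y) x = (\<Sum>i\<in>S. pd \<alpha> (f i) x)"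
proof -
  have "((\<lambda>y. \<Sum>i\<in>S. f i y) has_derivative (\<lambda>d. \<Sum>i\<in>S. frechet_derivative (f i) (at x) d)) (at x)"
    using assms by (intro has_derivative_sum) (simp add: frechet_derivative_works)
  from pd_eqI[OF this] show ?thesis by (simp add: pd_def)
qed

lemma pd_add:
  assumes "f differentiable at x" "g differentiable at x"
  shows "pd \<alpha> (\<lambda>y. f y + g y) x = pd \<alpha> f x + pd \<alpha> g x"
  using pd_eqI[OF has_derivative_add[OF assms[unfolded frechet_derivative_works]]]
  by (simp add: pd_def)

lemma pd_diff:
  assumes "f differentiable at x" "g differentiable at x"
  shows "pd \<alpha> (\<lambda>y. f y - g y) x = pd \<alpha> f x - pd \<alpha> g x"
  using pd_eqI[OF has_derivative_diff[OF assms[unfolded frechet_derivative_works]]]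
  by (simp add: pd_def)

lemma pd_compose:
  assumes "(\<phi> has_real_derivative d) (at (f x))" "f differentiable at x"
  shows "pd \<alpha> (\<lambda>y. \<phi> (f y)) x = d * pd \<alpha> f x"
    and "(\<lambda>y. \<phi> (f y)) differentiable at x"
proof -
  have "((\<lambda>y. \<phi> (f y)) has_derivative (\<lambda>z. d * frechet_derivative f (at x) z)) (at x)"
    using has_derivative_compose[OF assms(2)[unfolded frechet_derivative_works]
        assms(1)[unfolded has_field_derivative_def]] .
  from pd_eqI[OF this] this show "pd \<alpha> (\<lambda>y. \<phi> (f y)) x = d * pd \<alpha> f x"
    and "(\<lambda>y. \<phi> (f y)) differentiable at x"
    by (auto simp: pd_def differentiable_def)
qed

section \<open>Symmetry of second partial derivatives\<close>

lemma pd_along_line: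
  assumes "f differentiable at (p + s *\<^sub>R axis \<alpha> 1)"
  shows "((\<lambda>s. f (p + s *\<^sub>R axis \<alpha> 1)) has_real_derivative pd \<alpha> f (p + s *\<^sub>R axis \<alpha> 1)) (at s)"
proof -
  let ?L = "frechet_derivative f (at (p + s *\<^sub>R axis \<alpha> 1))"
  have L: "(f has_derivative ?L) (at (p + s *\<^sub>R axis \<alpha> 1))"
    using assms by (simp add: frechet_derivative_works)
  have "((\<lambda>s. p + s *\<^sub>R axis \<alpha> 1) has_derivative (\<lambda>t. t *\<^sub>R axis \<alpha> 1)) (at s)"
    by (auto intro!: derivative_eq_intros)
  from has_derivative_compose[OF this L]
  have "((\<lambda>s. f (p + s *\<^sub>R axis \<alpha> 1)) has_derivative (\<lambda>t. ?L (t *\<^sub>R axis \<alpha> 1))) (at s)" .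
  moreover have "(\<lambda>t. ?L (t *\<^sub>R axis \<alpha> 1)) = (*) (pd \<alpha> f (p + s *\<^sub>R axis \<alpha> 1))"
    using linear_scale[OF has_derivative_linear[OF L]] by (auto simp: pd_def)
  ultimately show ?thesis by (simp add: has_field_derivative_def)
qed

text \<open>
  The second difference is \<open>G d - G 0\<close> where \<open>G\<close> is the increment of \<open>f\<close> in direction \<open>\<beta>\<close>. One mean
  value theorem for \<open>G\<close> produces \<open>\<partial>\<^sub>\<alpha>\<close>, a second one in direction \<open>\<beta>\<close> produces \<open>\<partial>\<^sub>\<beta> \<partial>\<^sub>\<alpha>\<close>. The
  difference itself is symmetric in \<open>\<alpha>\<close> and \<open>\<beta>\<close>, which is what makes the lemma useful.
\<close>

lemma mixed_difference:
  assumes f: "\<And>y. y \<in> ball x r \<Longrightarrow> f differentiable at y"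
    and pf: "\<And>y. y \<in> ball x r \<Longrightarrow> pd \<alpha> f differentiable at y"
    and d: "0 < d" "2 * d < r"
  shows "\<exists>y\<in>ball x r. f (x + d *\<^sub>R axis \<alpha> 1 + d *\<^sub>R axis \<beta> 1) - f (x + d *\<^sub>R axis \<alpha> 1)
            - f (x + d *\<^sub>R axis \<beta> 1) + f x = d\<^sup>2 * pd \<beta> (pd \<alpha> f) y"
proof -
  let ?a = "axis \<alpha> 1 :: real ^ 3" and ?b = "axis \<beta> 1 :: real ^ 3"
  have in_ball: "x + s *\<^sub>R ?a + t *\<^sub>R ?b \<in> ball x r" if "0 \<le> s" "s \<le> d" "0 \<le> t" "t \<le> d" for s t
  proof -
    have "norm (s *\<^sub>R ?a + t *\<^sub>R ?b) \<le> s + t"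
      using norm_triangle_ineq[of "s *\<^sub>R ?a" "t *\<^sub>R ?b"] that by simp
    moreover have "dist x (x + s *\<^sub>R ?a + t *\<^sub>R ?b) = norm (s *\<^sub>R ?a + t *\<^sub>R ?b)"
      by (metis add.assoc dist_add_cancel dist_0_norm add.right_neutral)
    ultimately show ?thesis using that d by simp
  qed
  define G where "G s = f (x + d *\<^sub>R ?b + s *\<^sub>R ?a) - f (x + s *\<^sub>R ?a)" for s
  define G' where "G' s = pd \<alpha> f (x + d *\<^sub>R ?b + s *\<^sub>R ?a) - pd \<alpha> f (x + s *\<^sub>R ?a)" for s
  have "DERIV G s :> G' s" if "0 \<le> s" "s \<le> d" for s
    unfolding G_def G'_def
    using in_ball[of s d] in_ball[of s 0] that d
    by (intro DERIV_diff pd_along_line f) (auto simp: add_ac)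
  from MVT2[OF d(1) this] obtain s where s: "0 < s" "s < d" "G d - G 0 = d * G' s"
    by auto
  have "DERIV (\<lambda>t. pd \<alpha> f (x + s *\<^sub>R ?a + t *\<^sub>R ?b)) t :> pd \<beta> (pd \<alpha> f) (x + s *\<^sub>R ?a + t *\<^sub>R ?b)"
    if "0 \<le> t" "t \<le> d" for t
    using in_ball[of s t] that s by (intro pd_along_line pf) auto
  from MVT2[OF d(1) this] obtain t where t: "0 < t" "t < d"
      "pd \<alpha> f (x + s *\<^sub>R ?a + d *\<^sub>R ?b) - pd \<alpha> f (x + s *\<^sub>R ?a)
        = d * pd \<beta> (pd \<alpha> f) (x + s *\<^sub>R ?a + t *\<^sub>R ?b)"
    by auto
  have G's: "G' s = d * pd \<beta> (pd \<alpha> f) (x + s *\<^sub>R ?a + t *\<^sub>R ?b)"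
    using t(3) by (simp add: G'_def add_ac)
  have "f (x + d *\<^sub>R ?a + d *\<^sub>R ?b) - f (x + d *\<^sub>R ?a) - f (x + d *\<^sub>R ?b) + f x = G d - G 0"
    by (simp add: G_def add_ac)
  also have "\<dots> = d\<^sup>2 * pd \<beta> (pd \<alpha> f) (x + s *\<^sub>R ?a + t *\<^sub>R ?b)"
    by (simp add: s(3) G's power2_eq_square)
  finally show ?thesis using in_ball[of s t] s t by auto
qed

lemma C2_onD:
  assumes "open U" "C2_on U f" "x \<in> U"
  shows "f differentiable at x" "pd \<alpha> f differentiable at x" "isCont (pd \<beta> (pd \<alpha> f)) x"
  using assms
  by (auto simp: C2_on_def differentiable_on_eq_differentiable_at continuous_on_eq_continuous_at)

text \<open>
  Schwarz's theorem. The same second difference is \<open>d\<^sup>2\<close> times a value of either mixed derivative,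
  taken at two points near \<open>x\<close>; since both mixed derivatives are continuous at \<open>x\<close>, they
  cannot differ there.
\<close>

lemma pd_commute:
  assumes "open U" "C2_on U f" "x \<in> U"
  shows "pd \<beta> (pd \<alpha> f) x = pd \<alpha> (pd \<beta> f) x"
proof (rule ccontr)
  assume neq: "pd \<beta> (pd \<alpha> f) x \<noteq> pd \<alpha> (pd \<beta> f) x"
  define e where "e = \<bar>pd \<beta> (pd \<alpha> f) x - pd \<alpha> (pd \<beta> f) x\<bar> / 2"
  have "e > 0" using neq by (simp add: e_def)
  obtain r0 where r0: "r0 > 0" "ball x r0 \<subseteq> U" 
    using assms openE by blast
  obtain r1 where r1: "r1 > 0" "\<And>y. dist y x < r1 \<Longrightarrow> dist (pd \<beta> (pd \<alpha> f) y) (pd \<beta> (pd \<alpha> f) x) < e"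
    using C2_onD(3)[OF assms] \<open>e > 0\<close> unfolding continuous_at_eps_delta by metis
  obtain r2 where r2: "r2 > 0" "\<And>y. dist y x < r2 \<Longrightarrow> dist (pd \<alpha> (pd \<beta> f) y) (pd \<alpha> (pd \<beta> f) x) < e"
    using C2_onD(3)[OF assms] \<open>e > 0\<close> unfolding continuous_at_eps_delta by metis
  define r where "r = Min {r0, r1, r2}"
  have r: "r > 0" "r \<le> r0" "r \<le> r1" "r \<le> r2"
    using r0 r1 r2 by (auto simp: r_def)
  \<comment> \<open>Any step size below \<open>r / 2\<close> keeps the square with sides \<open>d\<close> inside the ball.\<close>
  define d where "d = r / 3"
  have d: "0 < d" "2 * d < r" using r by (auto simp: d_def)
  have inU: "y \<in> U" if "y \<in> ball x r" for y using that r r0 by auto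
  note diff = C2_onD(1,2)[OF assms(1,2) inU]
  obtain y where y: "y \<in> ball x r"
      "f (x + d *\<^sub>R axis \<alpha> 1 + d *\<^sub>R axis \<beta> 1) - f (x + d *\<^sub>R axis \<alpha> 1)
        - f (x + d *\<^sub>R axis \<beta> 1) + f x = d\<^sup>2 * pd \<beta> (pd \<alpha> f) y"
    using mixed_difference[OF diff d] by blast
  obtain z where z: "z \<in> ball x r"
      "f (x + d *\<^sub>R axis \<beta> 1 + d *\<^sub>R axis \<alpha> 1) - f (x + d *\<^sub>R axis \<beta> 1)
        - f (x + d *\<^sub>R axis \<alpha> 1) + f x = d\<^sup>2 * pd \<alpha> (pd \<beta> f) z"
    using mixed_difference[OF diff d] by blast
  have "d\<^sup>2 * pd \<beta> (pd \<alpha> f) y = d\<^sup>2 * pd \<alpha> (pd \<beta> f) z"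
    using y(2) z(2) unfolding add.assoc add.commute[of "d *\<^sub>R axis \<alpha> 1" "d *\<^sub>R axis \<beta> 1"]
    by linarith
  then have "pd \<beta> (pd \<alpha> f) y = pd \<alpha> (pd \<beta> f) z" using d by simp
  moreover have "\<bar>pd \<beta> (pd \<alpha> f) y - pd \<beta> (pd \<alpha> f) x\<bar> < e"
    using r1(2)[of y] y(1) r by (simp add: dist_commute dist_real_def)
  moreover have "\<bar>pd \<alpha> (pd \<beta> f) z - pd \<alpha> (pd \<beta> f) x\<bar> < e"
    using r2(2)[of z] z(1) r by (simp add: dist_commute dist_real_def)
  ultimately show False unfolding e_def by (simp add: abs_if split: if_splits)
qed

section \<open>Derivatives along a vector field, divergence and curl\<close>

definition transport :: "(real ^ 3 \<Rightarrow> real ^ 3) \<Rightarrow> (real ^ 3 \<Rightarrow> real) \<Rightarrow> real ^ 3 \<Rightarrow> real" where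
  "transport v f x = (\<Sum>\<kappa>\<in>UNIV. up v \<kappa> x * pd \<kappa> f x)"

definition dalembertian :: "(real ^ 3 \<Rightarrow> real) \<Rightarrow> real ^ 3 \<Rightarrow> real" where
  "dalembertian f x = (\<Sum>\<alpha>\<in>UNIV. \<Sum>\<beta>\<in>UNIV. mink \<alpha> \<beta> * pd \<alpha> (pd \<beta> f) x)"

lemma dalembertian_eq: "dalembertian f x = (\<Sum>\<alpha>\<in>UNIV. mink \<alpha> \<alpha> * pd \<alpha> (pd \<alpha> f) x)"
  by (simp add: dalembertian_def sum_mink)

locale C2_field =
  fixes U :: "(real ^ 3) set" and v :: "real ^ 3 \<Rightarrow> real ^ 3"
  assumes open_U: "open U" and C2_v: "C2_on U (up v \<alpha>)"
begin

lemmas v_diff = C2_onD(1,2)[OF open_U C2_v]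

lemma transport_differentiable:
  assumes "C2_on U f" "x \<in> U"
  shows "transport v f differentiable at x"
  unfolding transport_def using v_diff C2_onD[OF open_U assms] assms
  by (intro differentiable_sum differentiable_mult) auto

lemma pd_transport:
  assumes "C2_on U f" "x \<in> U"
  shows "pd \<alpha> (transport v f) x
    = (\<Sum>\<kappa>\<in>UNIV. pd \<alpha> (up v \<kappa>) x * pd \<kappa> f x) + transport v (pd \<alpha> f) x"
proof -
  have "pd \<alpha> (transport v f) x
      = (\<Sum>\<kappa>\<in>UNIV. pd \<alpha> (up v \<kappa>) x * pd \<kappa> f x + up v \<kappa> x * pd \<alpha> (pd \<kappa> f) x)"
    unfolding transport_def using v_diff C2_onD[OF open_U assms] assms
    by (simp add: pd_sum pd_mult)
  then show ?thesis
    by (simp add: sum.distrib transport_def pd_commute[OF open_U assms, of \<alpha>])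
qed

text \<open>
  The Leibniz rule for \<open>v\<^sup>\<alpha> \<partial>\<^sub>\<alpha> (v\<^sup>\<beta> \<partial>\<^sub>\<beta> f)\<close>. It replaces the part of the wave operator that is
  quadratic in \<open>v\<close> by iterated flow derivatives, on which the equations of motion can act.
\<close>

lemma second_derivative_along_v:
  assumes "C2_on U f" "x \<in> U"
  shows "(\<Sum>\<alpha>\<in>UNIV. \<Sum>\<beta>\<in>UNIV. up v \<alpha> x * up v \<beta> x * pd \<alpha> (pd \<beta> f) x)
    = transport v (transport v f) x - (\<Sum>\<beta>\<in>UNIV. transport v (up v \<beta>) x * pd \<beta> f x)"
proof -
  have "transport v (transport v f) x = (\<Sum>\<alpha>\<in>UNIV. up v \<alpha> x * pd \<alpha> (transport v f) x)"
    by (simp add: transport_def)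
  also have "\<dots> = (\<Sum>\<beta>\<in>UNIV. transport v (up v \<beta>) x * pd \<beta> f x)
      + (\<Sum>\<alpha>\<in>UNIV. \<Sum>\<beta>\<in>UNIV. up v \<alpha> x * up v \<beta> x * pd \<alpha> (pd \<beta> f) x)"
    using assms by (simp add: pd_transport pd_commute[OF open_U assms] transport_def sum_index algebra_simps)
  finally show ?thesis by simp
qed

text \<open>
  The commutator of the divergence and the flow derivative is quadratic in first derivatives.
\<close>

lemma divergence_transport:
  assumes "x \<in> U"
  shows "(\<Sum>\<kappa>\<in>UNIV. pd \<kappa> (transport v (up v \<kappa>)) x)
    = (\<Sum>\<kappa>\<in>UNIV. \<Sum>\<beta>\<in>UNIV. pd \<kappa> (up v \<beta>) x * pd \<beta> (up v \<kappa>) x) + transport v (div_field v) x"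
proof -
  have "pd \<alpha> (div_field v) x = (\<Sum>\<kappa>\<in>UNIV. pd \<alpha> (pd \<kappa> (up v \<kappa>)) x)" for \<alpha>
    unfolding div_field_def using v_diff assms by (simp add: pd_sum)
  then show ?thesis
    using assms C2_v by (simp add: pd_transport transport_def sum_index algebra_simps)
qed

lemma div_differentiable: "x \<in> U \<Longrightarrow> div_field v differentiable at x"
  unfolding div_field_def using v_diff by (intro differentiable_sum) auto

lemma curl_component:
  assumes "x \<in> U"
  shows "up (curl v) \<alpha> x = (\<Sum>\<beta>\<in>UNIV. \<Sum>\<gamma>\<in>UNIV. eps \<alpha> \<beta> \<gamma> * (mink \<gamma> \<gamma> * pd \<beta> (up v \<gamma>) x))"
  using v_diff assms by (simp add: up_def[of "curl v"] curl_def low_eq pd_cmult)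

lemma curl_differentiable:
  assumes "x \<in> U" shows "up (curl v) \<alpha> differentiable at x"
proof -
  have "(\<lambda>x. \<Sum>\<beta>\<in>UNIV. \<Sum>\<gamma>\<in>UNIV. eps \<alpha> \<beta> \<gamma> * (mink \<gamma> \<gamma> * pd \<beta> (up v \<gamma>) x)) differentiable at x"
    using v_diff assms by (intro differentiable_sum differentiable_mult) auto
  from differentiable_cong_on_open[OF open_U assms _ this] show ?thesis
    by (simp add: curl_component)
qed

lemma pd_curl:
  assumes "x \<in> U"
  shows "pd \<mu> (up (curl v) \<alpha>) x
    = (\<Sum>\<beta>\<in>UNIV. \<Sum>\<gamma>\<in>UNIV. eps \<alpha> \<beta> \<gamma> * (mink \<gamma> \<gamma> * pd \<mu> (pd \<beta> (up v \<gamma>)) x))"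
proof -
  have "pd \<mu> (up (curl v) \<alpha>) x = pd \<mu> (\<lambda>x. \<Sum>\<beta>\<in>UNIV. \<Sum>\<gamma>\<in>UNIV. eps \<alpha> \<beta> \<gamma> * (mink \<gamma> \<gamma> * pd \<beta> (up v \<gamma>) x)) x"
    using assms by (intro pd_cong[OF open_U]) (auto intro: curl_component curl_differentiable)
  then show ?thesis
    using v_diff assms by (simp add: pd_sum pd_cmult differentiable_mult)
qed

text \<open>
  Contracting two \<open>eps\<close> symbols with one \<open>mink\<close> gives \<open>det mink = -1\<close> times the Euclidean
  antisymmetrizer. Hence the d'Alembertian enters with a plus sign here, whereas the Laplacian enters
  the Euclidean identity with a minus sign.
\<close>

lemma curl_curl:
  assumes "x \<in> U"
  shows "up (curl (curl v)) \<alpha> x = dalembertian (up v \<alpha>) x - pd_up \<alpha> (div_field v) x"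
proof -
  have comm: "pd \<beta> (pd \<alpha> (up v \<gamma>)) x = pd \<alpha> (pd \<beta> (up v \<gamma>)) x" for \<alpha> \<beta> \<gamma>
    by (rule pd_commute[OF open_U C2_v assms])
  have "up (curl (curl v)) \<alpha> x
     = (\<Sum>\<beta>\<in>UNIV. \<Sum>\<gamma>\<in>UNIV. eps \<alpha> \<beta> \<gamma> * (mink \<gamma> \<gamma> * pd \<beta> (up (curl v) \<gamma>) x))"
    using curl_differentiable[OF assms]
    by (simp add: up_def[of "curl (curl v)"] curl_def[of "curl v"] low_eq pd_cmult)
  moreover have "pd \<alpha> (div_field v) x = (\<Sum>\<kappa>\<in>UNIV. pd \<alpha> (pd \<kappa> (up v \<kappa>)) x)" 
    unfolding div_field_def using v_diff assms by (simp add: pd_sum)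
  moreover have "\<forall>\<alpha>. (\<Sum>\<beta>\<in>UNIV. \<Sum>\<gamma>\<in>UNIV. eps \<alpha> \<beta> \<gamma> * (mink \<gamma> \<gamma> * pd \<beta> (up (curl v) \<gamma>) x))
     = dalembertian (up v \<alpha>) x - mink \<alpha> \<alpha> * (\<Sum>\<kappa>\<in>UNIV. pd \<alpha> (pd \<kappa> (up v \<kappa>)) x)"
    by (simp add: all_index pd_curl[OF assms] dalembertian_eq sum_index eps_def mink_def comm algebra_simps)
  ultimately show ?thesis by (simp add: pd_up_eq)
qed

end

section \<open>The wave and transport equations of a relativistic fluid\<close>

text \<open>
  The flow derivative is folded into \<open>transport\<close>, so that both equations of motion are identities
  between functions on \<open>U\<close> and can be differentiated once more.
\<close>

locale relativistic_fluid = C2_field U v for U v +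
  fixes cs :: "real \<Rightarrow> real" and h :: "real ^ 3 \<Rightarrow> real"
  assumes C2_h: "C2_on U h"
    and cs_diff: "x \<in> U \<Longrightarrow> cs differentiable at (h x)"
    and cs_nz: "x \<in> U \<Longrightarrow> cs (h x) \<noteq> 0"
    and continuity: "x \<in> U \<Longrightarrow>
      (1 - (cs (h x))\<^sup>2) * transport v h x + (cs (h x))\<^sup>2 * div_field v x = 0"
    and momentum: "x \<in> U \<Longrightarrow> transport v (up v \<alpha>) x = - exp (2 * h x) * pd_up \<alpha> h x"
begin

lemmas h_diff = C2_onD(1,2)[OF open_U C2_h]

lemma pd_exp_2h:
  assumes "x \<in> U"
  shows "(\<lambda>y. exp (2 * h y)) differentiable at x"
    and "pd \<alpha> (\<lambda>y. exp (2 * h y)) x = 2 * exp (2 * h x) * pd \<alpha> h x"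
proof -
  have "((\<lambda>s. exp (2 * s)) has_real_derivative 2 * exp (2 * h x)) (at (h x))"
    by (auto intro!: derivative_eq_intros)
  from pd_compose[OF this h_diff(1)[OF assms]]
  show "(\<lambda>y. exp (2 * h y)) differentiable at x"
    and "pd \<alpha> (\<lambda>y. exp (2 * h y)) x = 2 * exp (2 * h x) * pd \<alpha> h x" by auto
qed

lemma pd_cs_squared:
  assumes "x \<in> U"
  shows "(\<lambda>y. (cs (h y))\<^sup>2) differentiable at x"
    and "pd \<alpha> (\<lambda>y. (cs (h y))\<^sup>2) x = 2 * cs (h x) * deriv cs (h x) * pd \<alpha> h x"
proof -
  have "(cs has_real_derivative deriv cs (h x)) (at (h x))"
    using cs_diff[OF assms] by (simp add: DERIV_deriv_iff_real_differentiable)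
  then have "((\<lambda>s. (cs s)\<^sup>2) has_real_derivative 2 * cs (h x) * deriv cs (h x)) (at (h x))"
    by (auto intro!: derivative_eq_intros)
  from pd_compose[OF this h_diff(1)[OF assms]]
  show "(\<lambda>y. (cs (h y))\<^sup>2) differentiable at x"
    and "pd \<alpha> (\<lambda>y. (cs (h y))\<^sup>2) x = 2 * cs (h x) * deriv cs (h x) * pd \<alpha> h x" by auto
qed

lemma wave_op_split:
  assumes "C2_on U f" "x \<in> U"
  shows "wave_op cs h v f x = Theta cs h v x * ((cs (h x))\<^sup>2 * dalembertian f x
    + exp (- 2 * h x) * ((cs (h x))\<^sup>2 - 1)
      * (transport v (transport v f) x - (\<Sum>\<beta>\<in>UNIV. transport v (up v \<beta>) x * pd \<beta> f x)))"
  unfolding second_derivative_along_v[OF assms, symmetric] dalembertian_def wave_op_def acoustic_def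
  by (simp add: sum_distrib_left sum.distrib sum_subtractf algebra_simps)

lemma pd_continuity:
  assumes "x \<in> U"
  shows "(1 - (cs (h x))\<^sup>2) * pd \<alpha> (transport v h) x + (cs (h x))\<^sup>2 * pd \<alpha> (div_field v) x
    = 2 * cs (h x) * deriv cs (h x) * pd \<alpha> h x * (transport v h x - div_field v x)"
proof -
  note diff = pd_cs_squared(1)[OF assms] transport_differentiable[OF C2_h assms]
    div_differentiable[OF assms]
  have "pd \<alpha> (\<lambda>y. transport v h y - (cs (h y))\<^sup>2 * transport v h y
      + (cs (h y))\<^sup>2 * div_field v y) x = pd \<alpha> (\<lambda>y. 0) x"
    by (rule pd_cong[OF open_U assms])
      (auto simp: diff left_diff_distrib dest: continuity)
  then have "pd \<alpha> (transport v h) x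
      - (2 * cs (h x) * deriv cs (h x) * pd \<alpha> h x * transport v h x
          + (cs (h x))\<^sup>2 * pd \<alpha> (transport v h) x)
      + (2 * cs (h x) * deriv cs (h x) * pd \<alpha> h x * div_field v x
          + (cs (h x))\<^sup>2 * pd \<alpha> (div_field v) x) = 0"
    using diff by (simp add: pd_add pd_diff pd_mult pd_const pd_cs_squared[OF assms])
  then show ?thesis by (simp add: algebra_simps)
qed

lemma pd_momentum:
  assumes "x \<in> U"
  shows "pd \<beta> (transport v (up v \<alpha>)) x
    = - exp (2 * h x) * mink \<alpha> \<alpha> * (2 * pd \<beta> h x * pd \<alpha> h x + pd \<beta> (pd \<alpha> h) x)"
proof -
  note diff = pd_exp_2h(1)[OF assms] h_diff(2)[OF assms]
  have "pd \<beta> (transport v (up v \<alpha>)) x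
      = pd \<beta> (\<lambda>y. - mink \<alpha> \<alpha> * (exp (2 * h y) * pd \<alpha> h y)) x"
    by (rule pd_cong[OF open_U assms])
      (auto simp: momentum pd_up_eq intro: transport_differentiable[OF C2_v assms])
  also have "\<dots> = - mink \<alpha> \<alpha> * (2 * exp (2 * h x) * pd \<beta> h x * pd \<alpha> h x
      + exp (2 * h x) * pd \<beta> (pd \<alpha> h) x)"
    using diff by (subst pd_cmult) (auto simp: pd_mult pd_exp_2h[OF assms])
  finally show ?thesis by (simp add: algebra_simps)
qed

text \<open>
  In the wave operator \<open>\<Theta>\<close> multiplies
  \<open>c\<^sub>s\<^sup>2 \<box>h - e\<^sup>-\<^sup>2\<^sup>h (1 - c\<^sub>s\<^sup>2) (B B h + e\<^sup>2\<^sup>h \<partial>h \<cdot> \<partial>h)\<close>,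
  and inserting the value of \<open>(1 - c\<^sub>s\<^sup>2) B B h\<close> found from \<open>B_cont\<close> and \<open>div_mom\<close> cancels \<open>\<box>h\<close>. The
  factor \<open>c\<^sub>s'/c\<^sub>s\<close> in \<open>D_term\<close> appears because the continuity equation gives
  \<open>B h - div v = c\<^sub>s\<^sup>-\<^sup>2 B h\<close>.
\<close>

lemma wave_equation_enthalpy:
  assumes "x \<in> U"
  shows "wave_op cs h v h x = D_term cs h v x"
proof -
  let ?c = "cs (h x)" and ?c' = "deriv cs (h x)" and ?\<Theta> = "Theta cs h v x"
  define e where "e = exp (- 2 * h x)"
  define E where "E = exp (2 * h x)"
  define b where "b = transport v h x"
  define X where "X = transport v (transport v h) x"
  define Y where "Y = transport v (div_field v) x"
  define P where "P = (\<Sum>\<kappa>\<in>UNIV. pd \<kappa> h x * pd_up \<kappa> h x)"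
  define R where "R = (\<Sum>\<kappa>\<in>UNIV. \<Sum>\<beta>\<in>UNIV. pd \<kappa> (up v \<beta>) x * pd \<beta> (up v \<kappa>) x)"
  have eE: "e * E = 1" by (simp add: e_def E_def flip: exp_add)
  have "?c\<^sup>2 * (b - div_field v x) = b"
    using continuity[OF assms] by (simp add: b_def algebra_simps)
  then have cont: "?c * (b - div_field v x) = inverse ?c * b"
    using cs_nz[OF assms] by (simp add: field_simps power2_eq_square)
  have "(1 - ?c\<^sup>2) * X + ?c\<^sup>2 * Y
     = (\<Sum>\<alpha>\<in>UNIV. up v \<alpha> x * ((1 - ?c\<^sup>2) * pd \<alpha> (transport v h) x + ?c\<^sup>2 * pd \<alpha> (div_field v) x))"
    by (simp add: X_def Y_def transport_def[of v "transport v h"] transport_def[of v "div_field v"]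
        sum_distrib_left sum.distrib sum_subtractf algebra_simps)
  also have "\<dots> = 2 * ?c * ?c' * b * (b - div_field v x)"
    unfolding pd_continuity[OF assms]
    by (simp add: b_def transport_def sum_distrib_right sum_distrib_left algebra_simps)
  finally have B_cont: "(1 - ?c\<^sup>2) * X + ?c\<^sup>2 * Y = 2 * ?c * ?c' * b * (b - div_field v x)" .
  have div_mom: "R + Y = - E * (2 * P + dalembertian h x)"
    using divergence_transport[OF assms] unfolding pd_momentum[OF assms]
    by (simp add: R_def Y_def P_def E_def dalembertian_eq pd_up_eq sum_distrib_left sum.distrib
        sum_negf sum_subtractf algebra_simps)
  have dv_dh: "(\<Sum>\<beta>\<in>UNIV. transport v (up v \<beta>) x * pd \<beta> h x) = - E * P"
    by (simp add: momentum[OF assms] E_def P_def sum_distrib_left sum_negf algebra_simps)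
  have b2: "(\<Sum>\<beta>\<in>UNIV. \<Sum>\<kappa>\<in>UNIV. up v \<beta> x * up v \<kappa> x * pd \<beta> h x * pd \<kappa> h x) = b\<^sup>2"
    by (simp add: b_def transport_def sum_product power2_eq_square algebra_simps)
  have "wave_op cs h v h x = ?\<Theta> * (?c\<^sup>2 * dalembertian h x + e * (?c\<^sup>2 - 1) * (X + E * P))"
    by (simp add: wave_op_split[OF C2_h assms] e_def X_def dv_dh)
  also have "\<dots> = - 2 * e * ?\<Theta> * inverse ?c * ?c' * b\<^sup>2 - e * ?\<Theta> * ?c\<^sup>2 * R - ?\<Theta> * (1 + ?c\<^sup>2) * P"
    using eE cont B_cont div_mom by algebra
  also have "\<dots> = D_term cs h v x"
    by (simp add: D_term_def Let_def b2 e_def P_def R_def)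
  finally show ?thesis .
qed

text \<open>
  The second derivatives other than the curl of the vorticity are \<open>c\<^sub>s\<^sup>2 \<partial>\<^sup>\<alpha> div v\<close> and
  \<open>(1 - c\<^sub>s\<^sup>2) \<partial>\<^sup>\<alpha> B h\<close>. Their sum is the principal part of the differentiated continuity equation
  \<open>cont\<close>, hence a quadratic term with the factor \<open>2 c\<^sub>s c\<^sub>s'\<close>.
\<close>

lemma wave_equation_velocity:
  assumes "x \<in> U"
  shows "wave_op cs h v (up v \<alpha>) x
    = (cs (h x))\<^sup>2 * Theta cs h v x * up (curl (curl v)) \<alpha> x + Q_term cs h v \<alpha> x"
proof -
  let ?c = "cs (h x)" and ?c' = "deriv cs (h x)" and ?\<Theta> = "Theta cs h v x"
  define e where "e = exp (- 2 * h x)"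
  define E where "E = exp (2 * h x)"
  define b where "b = transport v h x"
  define p where "p = pd_up \<alpha> h x"
  define S where "S = (\<Sum>\<beta>\<in>UNIV. pd_up \<alpha> (up v \<beta>) x * pd \<beta> h x)"
  define A where "A = (\<Sum>\<beta>\<in>UNIV. transport v (up v \<beta>) x * pd \<beta> (up v \<alpha>) x)"
  have eE: "e * E = 1" by (simp add: e_def E_def flip: exp_add)
  have "transport v (transport v (up v \<alpha>)) x
      = - E * (2 * b * p + mink \<alpha> \<alpha> * transport v (pd \<alpha> h) x)"
    unfolding transport_def[of v "transport v (up v \<alpha>)"] pd_momentum[OF assms]
    by (simp add: b_def p_def transport_def E_def pd_up_eq sum_index algebra_simps)
  also have "mink \<alpha> \<alpha> * transport v (pd \<alpha> h) x = pd_up \<alpha> (transport v h) x - S"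
    by (simp add: pd_up_eq pd_transport[OF C2_h assms] S_def sum_distrib_left algebra_simps)
  finally have BB: "transport v (transport v (up v \<alpha>)) x
      = - E * (2 * b * p + pd_up \<alpha> (transport v h) x - S)" by simp
  have cont: "(1 - ?c\<^sup>2) * pd_up \<alpha> (transport v h) x + ?c\<^sup>2 * pd_up \<alpha> (div_field v) x
      = 2 * ?c * ?c' * p * (b - div_field v x)"
    using arg_cong[OF pd_continuity[OF assms, of \<alpha>], of "\<lambda>z. mink \<alpha> \<alpha> * z"]
    by (simp add: pd_up_eq p_def b_def algebra_simps)
  have A: "(\<Sum>\<beta>\<in>UNIV. \<Sum>\<kappa>\<in>UNIV. up v \<beta> x * pd \<beta> (up v \<kappa>) x * pd \<kappa> (up v \<alpha>) x) = A"
    by (simp add: A_def transport_def sum_index algebra_simps)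
  have bp: "(\<Sum>\<beta>\<in>UNIV. up v \<beta> x * pd \<beta> h x * p) = b * p"
    "(\<Sum>\<beta>\<in>UNIV. up v \<beta> x * p * pd \<beta> h x) = b * p"
    by (simp_all add: b_def transport_def sum_distrib_right sum_distrib_left algebra_simps)
  have "wave_op cs h v (up v \<alpha>) x
      = ?\<Theta> * (?c\<^sup>2 * (up (curl (curl v)) \<alpha> x + pd_up \<alpha> (div_field v) x)
          + e * (?c\<^sup>2 - 1) * (- E * (2 * b * p + pd_up \<alpha> (transport v h) x - S) - A))"
    by (simp add: wave_op_split[OF C2_v assms] curl_curl[OF assms] e_def BB A_def)
  also have "\<dots> = ?c\<^sup>2 * ?\<Theta> * up (curl (curl v)) \<alpha> x
      - e * (?c\<^sup>2 - 1) * ?\<Theta> * A - 2 * (?c\<^sup>2 - 1) * ?\<Theta> * (b * p)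
      - 2 * ?\<Theta> * ?c * ?c' * p * div_field v x + (?c\<^sup>2 - 1) * ?\<Theta> * S + 2 * ?\<Theta> * ?c * ?c' * (b * p)"
    using eE cont by algebra
  also have "\<dots> = ?c\<^sup>2 * ?\<Theta> * up (curl (curl v)) \<alpha> x + Q_term cs h v \<alpha> x"
    by (simp add: Q_term_def Let_def A S_def[symmetric] p_def[symmetric] bp e_def)
  finally show ?thesis .
qed

text \<open>
  Since \<open>curl (B v) = 0\<close>, \<open>B w\<^sup>\<alpha>\<close> is minus the commutator \<open>\<epsilon>\<^sup>\<alpha>\<^sup>\<beta>\<^sup>\<gamma> \<partial>\<^sub>\<beta> v\<^sup>\<kappa> \<partial>\<^sub>\<kappa> v\<^sub>\<gamma>\<close>. Splitting
  \<open>\<partial>\<^sub>\<kappa> v\<^sub>\<gamma>\<close> into \<open>\<partial>\<^sub>\<gamma> v\<^sub>\<kappa>\<close>, whose contribution is symmetric in \<open>\<beta>\<close> and \<open>\<gamma>\<close> and drops out, and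
  its antisymmetric part, which is the dual of \<open>w\<close>, gives \<open>w\<^sup>\<kappa> \<partial>\<^sub>\<kappa> v\<^sup>\<alpha> - w\<^sup>\<alpha> div v\<close>. Here
  \<open>w\<^sup>\<kappa> \<partial>\<^sub>\<kappa> v\<^sup>\<alpha>\<close> may be replaced by \<open>w\<^sup>\<kappa> \<partial>\<^sup>\<alpha> v\<^sub>\<kappa>\<close>, because the dual of \<open>w\<close> annihilates \<open>w\<close>.
\<close>

lemma vorticity_transport:
  assumes "x \<in> U"
  shows "transport v (up (curl v) \<alpha>) x
    = (\<Sum>\<kappa>\<in>UNIV. up (curl v) \<kappa> x * pd_up \<alpha> (low v \<kappa>) x) - up (curl v) \<alpha> x * div_field v x"
proof -
  \<comment> \<open>The terms \<open>\<partial>\<^sub>\<beta> h \<partial>\<^sub>\<gamma> h\<close> and \<open>\<partial>\<^sub>\<beta> \<partial>\<^sub>\<gamma> h\<close> are symmetric, so they vanish against \<open>eps\<close>.\<close>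
  have curl_mom: "(\<Sum>\<beta>\<in>UNIV. \<Sum>\<gamma>\<in>UNIV. eps \<alpha> \<beta> \<gamma> * (mink \<gamma> \<gamma> * pd \<beta> (transport v (up v \<gamma>)) x)) = 0"
    for \<alpha>
  proof -
    have "\<forall>\<alpha>. (\<Sum>\<beta>\<in>UNIV. \<Sum>\<gamma>\<in>UNIV. eps \<alpha> \<beta> \<gamma> * (mink \<gamma> \<gamma> * pd \<beta> (transport v (up v \<gamma>)) x)) = 0"
      unfolding pd_momentum[OF assms]
      using pd_commute[OF open_U C2_h assms]
      by (simp add: all_index sum_index eps_def mink_def algebra_simps)
    then show ?thesis by blast
  qed
  have "transport v (up (curl v) \<alpha>) x
    = - (\<Sum>\<beta>\<in>UNIV. \<Sum>\<gamma>\<in>UNIV. eps \<alpha> \<beta> \<gamma> * (mink \<gamma> \<gamma> * (\<Sum>\<kappa>\<in>UNIV. pd \<beta> (up v \<kappa>) x * pd \<kappa> (up v \<gamma>) x)))"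
    using curl_mom[of \<alpha>] unfolding pd_transport[OF C2_v assms] pd_curl[OF assms] transport_def
    by (simp add: sum_index algebra_simps)
  moreover have "\<forall>\<alpha>. - (\<Sum>\<beta>\<in>UNIV. \<Sum>\<gamma>\<in>UNIV. eps \<alpha> \<beta> \<gamma> * (mink \<gamma> \<gamma> * (\<Sum>\<kappa>\<in>UNIV. pd \<beta> (up v \<kappa>) x * pd \<kappa> (up v \<gamma>) x)))
    = (\<Sum>\<kappa>\<in>UNIV. up (curl v) \<kappa> x * (mink \<alpha> \<alpha> * (mink \<kappa> \<kappa> * pd \<alpha> (up v \<kappa>) x)))
      - up (curl v) \<alpha> x * (\<Sum>\<kappa>\<in>UNIV. pd \<kappa> (up v \<kappa>) x)"
    unfolding curl_component[OF assms]
    by (simp add: all_index sum_index eps_def mink_def algebra_simps)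
  ultimately show ?thesis
    using v_diff(1)[OF assms] by (simp add: low_eq pd_up_eq pd_cmult div_field_def)
qed

end

theorem lemma1p1:
  fixes U :: "(real ^ 3) set" and I :: "real set"
    and cs :: "real \<Rightarrow> real"
    and h :: "real ^ 3 \<Rightarrow> real" and v w :: "real ^ 3 \<Rightarrow> real ^ 3"
  assumes "open U" and "open I" and "h ` U \<subseteq> I"
    and "smooth_real_on I cs"
    and "\<forall>s\<in>I. 0 < cs s \<and> cs s \<le> 1"
    and "C2_on U h" and "\<forall>\<alpha>. C2_on U (up v \<alpha>)"
    and "\<forall>x\<in>U. (\<Sum>\<alpha>\<in>UNIV. up v \<alpha> x * low v \<alpha> x) = - exp (2 * h x)"
    and "\<forall>x\<in>U. up v 0 x > 0"
    and "\<forall>x\<in>U. (1 - (cs (h x))\<^sup>2) * (\<Sum>\<kappa>\<in>UNIV. up v \<kappa> x * pd \<kappa> h x)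
                 + (cs (h x))\<^sup>2 * div_field v x = 0"
    and "\<forall>x\<in>U. \<forall>\<alpha>. (\<Sum>\<kappa>\<in>UNIV. up v \<kappa> x * pd \<kappa> (up v \<alpha>) x)
                 + exp (2 * h x) * pd_up \<alpha> h x = 0"
    and "w = curl v"
  shows "\<forall>x\<in>U.
     wave_op cs h v h x = D_term cs h v x \<and>
     (\<forall>\<alpha>. wave_op cs h v (up v \<alpha>) x
            = (cs (h x))\<^sup>2 * Theta cs h v x * up (curl w) \<alpha> x + Q_term cs h v \<alpha> x) \<and>
     (\<forall>\<alpha>. (\<Sum>\<kappa>\<in>UNIV. up v \<kappa> x * pd \<kappa> (up w \<alpha>) x)
            = (\<Sum>\<kappa>\<in>UNIV. up w \<kappa> x * pd_up \<alpha> (low v \<kappa>) x) - up w \<alpha> x * div_field v x)"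
proof
  fix x assume x: "x \<in> U"
  have cs_point: "cs differentiable at (h y)" "cs (h y) \<noteq> 0" if "y \<in> U" for y
  proof -
    have "h y \<in> I" using \<open>h ` U \<subseteq> I\<close> that by blast
    moreover have "cs differentiable_on I"
      using \<open>smooth_real_on I cs\<close>[unfolded smooth_real_on_def, rule_format, of 0] by simp
    ultimately show "cs differentiable at (h y)" "cs (h y) \<noteq> 0"
      using \<open>open I\<close> \<open>\<forall>s\<in>I. 0 < cs s \<and> cs s \<le> 1\<close>
      by (auto simp: differentiable_on_eq_differentiable_at)
  qed
  interpret relativistic_fluid U v cs h
  proof unfold_locales
    fix y \<alpha> assume y: "y \<in> U"
    show "transport v (up v \<alpha>) y = - exp (2 * h y) * pd_up \<alpha> h y"
      using assms(11)[rule_format, OF y, of \<alpha>] by (simp add: transport_def)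
  qed (use assms(1,6,7,10) cs_point in \<open>auto simp: transport_def\<close>)
  show "wave_op cs h v h x = D_term cs h v x \<and>
     (\<forall>\<alpha>. wave_op cs h v (up v \<alpha>) x
            = (cs (h x))\<^sup>2 * Theta cs h v x * up (curl w) \<alpha> x + Q_term cs h v \<alpha> x) \<and>
     (\<forall>\<alpha>. (\<Sum>\<kappa>\<in>UNIV. up v \<kappa> x * pd \<kappa> (up w \<alpha>) x)
            = (\<Sum>\<kappa>\<in>UNIV. up w \<kappa> x * pd_up \<alpha> (low v \<kappa>) x) - up w \<alpha> x * div_field v x)"
    unfolding \<open>w = curl v\<close> transport_def[symmetric]
    using wave_equation_enthalpy[OF x] wave_equation_velocity[OF x] vorticity_transport[OF x]
    by blast
qed

end
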